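(* Let $q$ be an odd prime power and let $g\ge 1$ be an integer. For every monic irreducible polynomial $P\in\mathbb{F}_q[T]$ of degree $2g$, $$M_{q,g}(P)=\frac{1}{q-1},\qquad\text{where}\qquad M_{q,g}(P):=\frac{1}{\#\mathcal{H}_{2g+1}}\sum_{D\in\mathcal{H}_{2g+1}}\chi_D(P)\sqrt{|P|}.$$
   Context: $\mathcal{H}_n$ denotes the set of monic square-free polynomials of degree $n$ in $\mathbb{F}_q[T]$. For a nonzero polynomial $f$, $|f|=q^{\deg f}$. For a monic polynomial $D\in\mathbb{F}_q[T]$ of positive degree that is not a perfect square, $\chi_D(f)=\left(\frac{D}{f}\right)$ is the quadratic residue symbol in $\mathbb{F}_q[T]$; in particular, for $P$ monic irreducible, $\chi_D(P)$ is $0$ if $P\mid D$, $1$ if $D$ is a nonzero square modulo $P$, and $-1$ otherwise. *)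

theory Defs
  imports
    "HOL-Computational_Algebra.Computational_Algebra"
    "HOL-Number_Theory.Cong"
    "HOL-Library.Cardinality"
begin

text \<open>
  The field \<open>\<F>\<^sub>q\<close> is an arbitrary type \<open>'a\<close> of sort \<open>{field, finite}\<close>, with \<open>q = CARD('a)\<close>.
\<close>

definition sqfree_monic :: "nat \<Rightarrow> 'a::{field,finite} poly set" where
  "sqfree_monic n = {D. lead_coeff D = 1 \<and> degree D = n \<and> squarefree D}"

definition poly_abs :: "'a::{field,finite} poly \<Rightarrow> real" where
  "poly_abs f = (if f = 0 then 0 else real CARD('a) ^ degree f)"

definition poly_Legendre :: "'a::{field,finite} poly \<Rightarrow> 'a poly \<Rightarrow> int" where
  "poly_Legendre D P =
     (if P dvd D then 0 else if \<exists>a. [a ^ 2 = D] (mod P) then 1 else - 1)"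

definition poly_multiplicity :: "'a::{field,finite} poly \<Rightarrow> 'a poly \<Rightarrow> nat" where
  "poly_multiplicity P f = (GREATEST k. P ^ k dvd f)"

text \<open>
  The quadratic residue symbol \<open>(D / f)\<close> for a nonzero lower entry \<open>f\<close>, obtained from the case of
  a monic irreducible lower entry by multiplicativity. The product is finite since \<open>f \<noteq> 0\<close>. It is
  written over the monic irreducible divisors and with \<^const>\<open>poly_multiplicity\<close> rather than over
  \<open>prime_factors f\<close> and with \<open>multiplicity\<close>, because the latter would restrict \<open>'a\<close> to types that
  carry a gcd structure.
\<close>

definition quad_symbol :: "'a::{field,finite} poly \<Rightarrow> 'a poly \<Rightarrow> int" where
  "quad_symbol D f =
     (\<Prod>P | lead_coeff P = 1 \<and> irreducible P \<and> P dvd f. poly_Legendre D P ^ poly_multiplicity P f)"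

definition chi :: "'a::{field,finite} poly \<Rightarrow> 'a poly \<Rightarrow> int" where
  "chi D f = quad_symbol D f"

definition M_mean :: "nat \<Rightarrow> 'a::{field,finite} poly \<Rightarrow> real" where
  "M_mean g P =
     1 / real (card (sqfree_monic (2 * g + 1) :: 'a poly set)) *
     (\<Sum>D\<in>sqfree_monic (2 * g + 1). real_of_int (chi D P) * sqrt (poly_abs P))"

lemma finite_sqfree_monic: "finite (sqfree_monic n :: 'a::{field,finite} poly set)"
proof (rule finite_subset)
  show "sqfree_monic n \<subseteq> Poly ` {xs :: 'a list. set xs \<subseteq> UNIV \<and> length xs \<le> Suc n}"
  proof
    fix D :: "'a poly"
    assume "D \<in> sqfree_monic n"
    then have "length (coeffs D) \<le> Suc n"
      by (auto simp: sqfree_monic_def length_coeffs_degree coeffs_def)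
    then show "D \<in> Poly ` {xs. set xs \<subseteq> UNIV \<and> length xs \<le> Suc n}"
      by (intro image_eqI[of _ _ "coeffs D"]) auto
  qed
  show "finite (Poly ` {xs :: 'a list. set xs \<subseteq> UNIV \<and> length xs \<le> Suc n})"
    by (intro finite_imageI finite_lists_length_le) auto
qed

lemma chi_irreducible:
  fixes D P :: "'a::{field,finite} poly"
  assumes "lead_coeff P = 1" "irreducible P"
  shows "chi D P = poly_Legendre D P"
proof -
  have "Q = P" if Q: "lead_coeff Q = 1" "irreducible Q" "Q dvd P" for Q
  proof -
    from Q obtain R where R: "P = Q * R" by auto
    with assms Q have "is_unit R" by (auto simp: irreducible_def)
    then obtain c where c: "R = [:c:]" by (auto simp: is_unit_poly_iff)
    have "lead_coeff P = lead_coeff Q * lead_coeff R"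
      unfolding R by (rule lead_coeff_mult)
    then have "c = 1" using assms(1) Q(1) by (simp add: c)
    then show ?thesis using R c by (simp add: one_pCons)
  qed
  then have "{Q. lead_coeff Q = 1 \<and> irreducible Q \<and> Q dvd P} = {P}"
    using assms by auto
  moreover have "poly_multiplicity P P = 1"
    unfolding poly_multiplicity_def
  proof (rule Greatest_equality)
    fix k assume k: "P ^ k dvd P"
    show "k \<le> 1"
    proof (rule ccontr)
      assume "\<not> k \<le> 1"
      then have "P ^ 2 dvd P"
        using dvd_trans[OF le_imp_power_dvd[of 2 k P] k] by simp
      then have "P * P dvd P * 1" by (simp only: power2_eq_square mult_1_right)
      moreover have "P \<noteq> 0" using assms(2) by auto
      ultimately have "P dvd 1" by (simp only: dvd_mult_cancel_left simp_thms)
      then show False using assms(2) by (auto simp: irreducible_def)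
    qed
  qed auto
  ultimately show ?thesis by (simp add: chi_def quad_symbol_def)
qed

end

theory Submission
  imports Defs
begin

text \<open>
  Write \<open>A\<^sub>n\<close> and \<open>B\<^sub>n\<close> for the sums of \<open>\<chi>\<^sub>D(P)\<close> over the monic and over the monic square-free
  polynomials \<open>D\<close> of degree \<open>n\<close>. Every monic polynomial is uniquely \<open>D E\<^sup>2\<close> with \<open>D\<close> square-free, and
  \<open>P\<close> does not divide an \<open>E\<close> of degree at most \<open>g\<close>, so \<open>B\<^bsub>2g+1\<^esub> = A\<^bsub>2g+1\<^esub> - q A\<^bsub>2g-1\<^esub>\<close>. Here \<open>A\<^bsub>2g+1\<^esub> = 0\<close>
  because the monic polynomials of degree at least \<open>2g\<close> are equidistributed modulo \<open>P\<close>. The value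
  \<open>A\<^bsub>2g-1\<^esub> = - q\<^bsup>g-1\<^esup>\<close> comes from counting the residues \<open>x\<close> modulo \<open>P\<close> for which \<open>x\<^sup>2 mod P\<close> is monic of
  degree \<open>2g - 1\<close>: this is counting the representations of 1 by a hyperbolic quadratic form in \<open>2g\<close>
  variables, which needs neither Gauss sums nor quadratic reciprocity. Hence \<open>B\<^bsub>2g+1\<^esub> = q\<^sup>g\<close>, while
  \<open>q\<^bsup>2g+1\<^esup> - q\<^bsup>2g\<^esup>\<close> polynomials \<open>D\<close> are averaged over.
\<close>

section \<open>Polynomials of bounded degree and monic polynomials\<close>

text \<open>The condition on coefficients is linear and admits the zero polynomial even for
  \<open>n = 0\<close>, where \<open>degree f < n\<close> would not.\<close>

definition polys_below :: "nat \<Rightarrow> 'a::zero poly set" where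
  "polys_below n = {f. \<forall>i\<ge>n. coeff f i = 0}"

definition monic_polys :: "nat \<Rightarrow> 'a::{field,finite} poly set" where
  "monic_polys n = {f. lead_coeff f = 1 \<and> degree f = n}"

lemma polys_below_iff: "f \<in> polys_below n \<longleftrightarrow> f = 0 \<or> degree f < n"
  unfolding polys_below_def
  by (auto simp: coeff_eq_0) (metis leading_coeff_0_iff not_le)

lemma zero_in_polys_below [simp]: "0 \<in> polys_below n"
  by (simp add: polys_below_def)

lemma polys_below_add:
  fixes f h :: "'a::field poly"
  shows "f \<in> polys_below n \<Longrightarrow> h \<in> polys_below n \<Longrightarrow> f + h \<in> polys_below n"
  by (simp add: polys_below_def)

lemma polys_below_diff:
  fixes f h :: "'a::field poly"
  shows "f \<in> polys_below n \<Longrightarrow> h \<in> polys_below n \<Longrightarrow> f - h \<in> polys_below n"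
  by (simp add: polys_below_def)

lemma polys_below_smult:
  fixes f :: "'a::field poly"
  shows "f \<in> polys_below n \<Longrightarrow> smult c f \<in> polys_below n"
  by (simp add: polys_below_def)

lemma mod_in_polys_below:
  fixes f P :: "'a::field poly"
  assumes "P \<noteq> 0"
  shows "f mod P \<in> polys_below (degree P)"
  using degree_mod_less[OF assms] by (simp add: polys_below_iff)

lemma mod_polys_below:
  fixes f P :: "'a::field poly"
  assumes "f \<in> polys_below (degree P)"
  shows "f mod P = f"
  using assms mod_poly_less by (auto simp: polys_below_iff)

lemma dvd_polys_below:
  fixes f P :: "'a::field poly"
  assumes "f \<in> polys_below (degree P)" "P dvd f"
  shows "f = 0"
  using assms mod_polys_below[of f P] by (simp add: dvd_eq_mod_eq_0)

lemma polys_below_card: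
  "finite (polys_below n :: 'a::{field,finite} poly set) \<and>
   card (polys_below n :: 'a poly set) = CARD('a) ^ n"
proof (induction n)
  case 0
  have "polys_below 0 = {0 :: 'a poly}"
    by (auto simp: polys_below_iff)
  then show ?case by simp
next
  case (Suc n)
  have "bij_betw (\<lambda>(c, f). pCons c f) (UNIV \<times> polys_below n) (polys_below (Suc n) :: 'a poly set)"
  proof (rule bij_betwI')
    fix f :: "'a poly" assume f: "f \<in> polys_below (Suc n)"
    obtain c h where ch: "f = pCons c h" by (cases f)
    have "coeff h i = 0" if "i \<ge> n" for i
      using f that unfolding ch polys_below_def by (auto dest: spec[of _ "Suc i"])
    then show "\<exists>x\<in>UNIV \<times> polys_below n. f = (case x of (c, f) \<Rightarrow> pCons c f)"
      using ch by (auto simp: polys_below_def)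
  qed (auto simp: polys_below_def coeff_pCons split: nat.splits)
  from bij_betw_finite[OF this] bij_betw_same_card[OF this] Suc show ?case
    by (auto simp: card_cartesian_product)
qed

lemmas finite_polys_below [simp] = polys_below_card[THEN conjunct1]
lemmas card_polys_below = polys_below_card[THEN conjunct2]

lemma monic_polys_iff:
  "f \<in> monic_polys n \<longleftrightarrow> coeff f n = 1 \<and> f \<in> polys_below (Suc n)"
proof
  assume "coeff f n = 1 \<and> f \<in> polys_below (Suc n)"
  then have "coeff f n = 1" "degree f \<le> n" by (auto simp: polys_below_iff)
  moreover from this have "degree f = n" by (intro antisym le_degree) auto
  ultimately show "f \<in> monic_polys n" by (simp add: monic_polys_def)
qed (auto simp: monic_polys_def polys_below_iff)

lemma bij_betw_monic_polys:
  "bij_betw (\<lambda>f. monom 1 n + f) (polys_below n) (monic_polys n :: 'a::{field,finite} poly set)"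
proof (rule bij_betw_byWitness[where f' = "\<lambda>f. f - monom 1 n"])
  show "(\<lambda>f. monom 1 n + f) ` polys_below n \<subseteq> (monic_polys n :: 'a poly set)"
    by (auto simp: monic_polys_iff polys_below_def)
  show "(\<lambda>f. f - monom 1 n) ` monic_polys n \<subseteq> (polys_below n :: 'a poly set)"
    by (auto simp: monic_polys_iff polys_below_def Suc_le_eq)
qed auto

lemma finite_monic_polys [simp]: "finite (monic_polys n)"
  using bij_betw_finite[OF bij_betw_monic_polys] by simp

lemma card_monic_polys: "card (monic_polys n :: 'a::{field,finite} poly set) = CARD('a) ^ n"
  using bij_betw_same_card[OF bij_betw_monic_polys, of n] by (metis card_polys_below)

lemma monic_polys_mult:
  assumes "f \<in> monic_polys m" "h \<in> monic_polys n"
  shows "f * h \<in> monic_polys (m + n)"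
proof -
  have "f \<noteq> 0" "h \<noteq> 0" using assms by (auto simp: monic_polys_def)
  moreover have "lead_coeff (f * h) = 1" using assms unfolding lead_coeff_mult by (auto simp: monic_polys_def)
  ultimately show ?thesis using assms by (auto simp: monic_polys_def degree_mult_eq)
qed

section \<open>Unique decomposition into a square-free part and a square\<close>

text \<open>A non-unit divisor of least degree is irreducible, since in any factorisation of it a
  non-unit factor already has full degree; over a field irreducible polynomials are prime.\<close>

lemma prime_elem_dvd_exists:
  fixes f :: "'a::field poly"
  assumes "f \<noteq> 0" "\<not> is_unit f"
  obtains Q where "prime_elem Q" "Q dvd f"
proof -
  define R where "R = (\<lambda>Q. Q dvd f \<and> \<not> is_unit Q)"
  have "R f" using assms by (simp add: R_def)
  then obtain Q where Q: "R Q" "\<And>h. R h \<Longrightarrow> degree Q \<le> degree h"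
    using ex_has_least_nat[of R f degree] by blast
  have "irreducible Q"
  proof (rule irreducibleI)
    show "Q \<noteq> 0" "\<not> is_unit Q" using Q(1) assms by (auto simp: R_def)
    fix a b assume ab: "Q = a * b"
    show "is_unit a \<or> is_unit b"
    proof (rule disjCI)
      assume "\<not> is_unit b"
      with ab Q(1) have "R b" by (auto simp: R_def dest: dvd_mult_right)
      then have "degree Q \<le> degree b" by (rule Q(2))
      with ab \<open>Q \<noteq> 0\<close> show "is_unit a" by (auto simp: degree_mult_eq is_unit_iff_degree)
    qed
  qed
  then show ?thesis using that Q(1) field_poly_irreducible_imp_prime by (auto simp: R_def)
qed

lemma monic_unit_eq_1:
  fixes f :: "'a::field poly"
  assumes "is_unit f" "lead_coeff f = 1"
  shows "f = 1"
proof -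
  obtain c where "f = [:c:]" using assms(1) is_unit_poly_iff by blast
  then show ?thesis using assms(2) by (simp add: one_pCons)
qed

text \<open>Induction on the degree: if \<open>f\<close> is not square-free, the square of a
  non-unit divides it. Made monic, this square is split off and leaves a monic cofactor of smaller
  degree.\<close>

lemma squarefree_times_square_exists:
  fixes f :: "'a::field poly"
  assumes "lead_coeff f = 1"
  shows "\<exists>D E. f = D * E\<^sup>2 \<and> lead_coeff D = 1 \<and> lead_coeff E = 1 \<and> squarefree D"
  using assms
proof (induction "degree f" arbitrary: f rule: less_induct)
  case less
  show ?case
  proof (cases "squarefree f")
    case True
    then show ?thesis using less.prems by (intro exI[of _ f] exI[of _ 1]) auto
  next
    case False
    then obtain x where x: "x\<^sup>2 dvd f" "\<not> is_unit x" by (auto simp: squarefree_def)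
    have f0: "f \<noteq> 0" using less.prems by auto
    then have x0: "x \<noteq> 0" using x by auto
    define y where "y = smult (inverse (lead_coeff x)) x"
    have y: "lead_coeff y = 1" "degree y = degree x" using x0 by (auto simp: y_def)
    have "y\<^sup>2 = smult ((inverse (lead_coeff x))\<^sup>2) (x\<^sup>2)"
      by (simp add: y_def smult_power)
    then have "y\<^sup>2 dvd f" using x x0 by (simp add: smult_dvd_iff)
    then obtain h where h: "f = y\<^sup>2 * h" by blast
    have "lead_coeff h = 1" using less.prems y(1) by (simp add: h lead_coeff_mult lead_coeff_power)
    moreover have "degree x > 0" using x(2) x0 by (auto simp: is_unit_iff_degree)
    then have "degree h < degree f"
      using f0 y(2) by (simp add: h degree_mult_eq degree_power_eq)
    ultimately obtain D E where
      "h = D * E\<^sup>2" "lead_coeff D = 1" "lead_coeff E = 1" "squarefree D"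
      using less.hyps by blast
    then show ?thesis using y(1)
      by (intro exI[of _ D] exI[of _ "E * y"])
         (auto simp: h lead_coeff_mult power_mult_distrib algebra_simps)
  qed
qed

text \<open>Descent on \<open>degree E\<close>: a prime factor \<open>Q\<close> of \<open>E\<close>
  also divides \<open>E'\<close> and can be cancelled from both. Once \<open>E = E'\<close> is
  known, \<open>D = D'\<close> follows by cancellation.\<close>

lemma squarefree_times_square_unique:
  fixes D E D' E' :: "'a::field poly"
  assumes "D * E\<^sup>2 = D' * E'\<^sup>2" "squarefree D" "squarefree D'"
    and "lead_coeff D = 1" "lead_coeff D' = 1" "lead_coeff E = 1" "lead_coeff E' = 1"
  shows "E = E'"
  using assms(1,6,7)
proof (induction "degree E" arbitrary: E E' rule: less_induct)
  case less
  show ?case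
  proof (cases "is_unit E")
    case True
    then have E: "E = 1" using less.prems monic_unit_eq_1 by blast
    then have "E'\<^sup>2 dvd D" using less.prems by simp
    then have "is_unit E'" using assms(2) squarefreeD by blast
    then show ?thesis using E less.prems monic_unit_eq_1 by blast
  next
    case False
    have E0: "E \<noteq> 0" using less.prems by auto
    then obtain Q where Q: "prime_elem Q" "Q dvd E"
      using False prime_elem_dvd_exists by blast
    have Q0: "Q \<noteq> 0" using Q E0 by auto
    \<comment> \<open>Otherwise both factors of \<open>Q\<^sup>2\<close> would have to divide
      \<open>D'\<close>, which is square-free.\<close>
    have "Q dvd E'"
    proof (rule ccontr)
      assume nd: "\<not> Q dvd E'"
      have "Q\<^sup>2 dvd D' * E'\<^sup>2" using Q less.prems(1) by (metis dvd_mult dvd_power_same)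
      moreover have "\<not> Q dvd E'\<^sup>2" using nd Q(1) prime_elem_dvd_power by blast
      moreover obtain h where h: "D' = Q * h"
        using calculation Q(1) by (metis dvd_mult_left power2_eq_square prime_elem_dvd_mult_iff dvdE)
      ultimately have "Q dvd h"
        using Q0 Q(1) by (simp add: power2_eq_square mult.assoc prime_elem_dvd_mult_iff)
      then have "Q\<^sup>2 dvd D'" by (simp add: h power2_eq_square)
      then show False using assms(3) squarefreeD Q(1) by (auto simp: prime_elem_def)
    qed
    obtain F where F: "E = Q * F" using Q by blast
    obtain F' where F': "E' = Q * F'" using \<open>Q dvd E'\<close> by blast
    \<comment> \<open>\<open>Q\<close> need not be monic, so \<open>F\<close> and \<open>F'\<close>
      have leading coefficient \<open>inverse c\<close>. Scaling by \<open>c\<close> makes them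
      monic for the induction hypothesis and multiplies both sides by the same
      \<open>c\<^sup>2\<close>.\<close>
    define c where "c = lead_coeff Q"
    have c0: "c \<noteq> 0" using Q0 by (simp add: c_def)
    have FF: "lead_coeff F = inverse c" "lead_coeff F' = inverse c"
      using less.prems c0 by (auto simp: F F' c_def lead_coeff_mult field_simps)
    have "Q\<^sup>2 * (D * F\<^sup>2) = Q\<^sup>2 * (D' * F'\<^sup>2)"
      using less.prems(1) by (simp add: F F' power_mult_distrib algebra_simps)
    then have "D * F\<^sup>2 = D' * F'\<^sup>2" using Q0 by simp
    then have "D * (smult c F)\<^sup>2 = D' * (smult c F')\<^sup>2" by (simp add: smult_power)
    moreover have "degree (smult c F) < degree E"
    proof -
      have "degree Q > 0" using Q(1) Q0 by (auto simp: prime_elem_def is_unit_iff_degree)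
      moreover have "F \<noteq> 0" using E0 F by auto
      ultimately show ?thesis using c0 Q0 by (simp add: F degree_mult_eq)
    qed
    ultimately have "smult c F = smult c F'"
      using less.hyps[of "smult c F" "smult c F'"] FF c0 by simp
    then have "smult (inverse c) (smult c F) = smult (inverse c) (smult c F')" by (rule arg_cong)
    then show ?thesis using F F' c0 by simp
  qed
qed

text \<open>The component \<open>e\<close> is the degree of \<open>E\<close>; carrying it separately
  lets sums be split by that degree.\<close>

lemma bij_betw_squarefree_times_square:
  "bij_betw (\<lambda>(e, E, D). D * E\<^sup>2)
     (SIGMA e:{..n div 2}. monic_polys e \<times> sqfree_monic (n - 2 * e))
     (monic_polys n :: 'a::{field,finite} poly set)"
  unfolding bij_betw_def
proof
  show "inj_on (\<lambda>(e, E, D). D * E\<^sup>2)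
     (SIGMA e:{..n div 2}. monic_polys e \<times> (sqfree_monic (n - 2 * e) :: 'a poly set))"
  proof (rule inj_onI)
    fix z z' :: "nat \<times> 'a poly \<times> 'a poly"
    assume z: "z \<in> (SIGMA e:{..n div 2}. monic_polys e \<times> sqfree_monic (n - 2 * e))"
        "z' \<in> (SIGMA e:{..n div 2}. monic_polys e \<times> sqfree_monic (n - 2 * e))"
      and eq: "(case z of (e, E, D) \<Rightarrow> D * E\<^sup>2) = (case z' of (e, E, D) \<Rightarrow> D * E\<^sup>2)"
    obtain e E D e' E' D' where zz: "z = (e, E, D)" "z' = (e', E', D')" by (metis prod.exhaust)
    have *: "E \<in> monic_polys e" "D \<in> sqfree_monic (n - 2 * e)"
      "E' \<in> monic_polys e'" "D' \<in> sqfree_monic (n - 2 * e')" "D * E\<^sup>2 = D' * E'\<^sup>2"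
      using z eq by (auto simp: zz)
    then have "E = E'"
      by (intro squarefree_times_square_unique[of D E D' E'])
         (auto simp: monic_polys_def sqfree_monic_def)
    moreover from * have "E \<noteq> 0" by (auto simp: monic_polys_def)
    ultimately show "z = z'" using * by (auto simp: zz monic_polys_def)
  qed
next
  show "(\<lambda>(e, E, D). D * E\<^sup>2) `
      (SIGMA e:{..n div 2}. monic_polys e \<times> (sqfree_monic (n - 2 * e) :: 'a poly set))
      = monic_polys n" (is "?L = ?R")
  proof (intro equalityI subsetI)
    fix f assume "f \<in> ?L"
    then obtain e E D where *: "e \<le> n div 2" "E \<in> monic_polys e" "D \<in> sqfree_monic (n - 2 * e)"
      and f: "f = D * E\<^sup>2" by auto
    then have "D \<in> monic_polys (n - 2 * e)" by (auto simp: monic_polys_def sqfree_monic_def)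
    then have "D * (E * E) \<in> monic_polys (n - 2 * e + (e + e))"
      using *(2) by (intro monic_polys_mult)
    moreover have "n - 2 * e + (e + e) = n" using *(1) by simp
    ultimately show "f \<in> ?R" by (simp add: f power2_eq_square)
  next
    fix f assume f: "f \<in> ?R"
    then obtain D E where *: "f = D * E\<^sup>2" "lead_coeff D = 1" "lead_coeff E = 1" "squarefree D"
      using squarefree_times_square_exists[of f] by (auto simp: monic_polys_def)
    then have "D \<noteq> 0" "E \<noteq> 0" by auto
    then have "n = degree D + 2 * degree E"
      using f by (simp add: *(1) monic_polys_def degree_mult_eq degree_power_eq)
    then show "f \<in> ?L" using *
      by (intro image_eqI[of _ _ "(degree E, E, D)"])
         (auto simp: monic_polys_def sqfree_monic_def)
  qed
qed

section \<open>Sums over monic and over square-free polynomials\<close>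

text \<open>Invariance of \<open>w\<close> is demanded only for the squares that occur in degree
  \<open>n\<close>: for an \<open>E\<close> divisible by \<open>P\<close>, multiplication by
  \<open>E\<^sup>2\<close> would make the Legendre symbol modulo \<open>P\<close> vanish.\<close>

lemma sum_monic_polys_eq:
  fixes w :: "'a::{field,finite} poly \<Rightarrow> int"
  assumes "\<And>D E. lead_coeff E = 1 \<Longrightarrow> 2 * degree E \<le> n \<Longrightarrow> w (D * E\<^sup>2) = w D"
  shows "(\<Sum>f\<in>monic_polys n. w f) =
         (\<Sum>e\<le>n div 2. int (CARD('a) ^ e) * (\<Sum>D\<in>sqfree_monic (n - 2 * e). w D))"
proof -
  have "(\<Sum>f\<in>monic_polys n. w f) =
      (\<Sum>(e, E, D)\<in>(SIGMA e:{..n div 2}. monic_polys e \<times> sqfree_monic (n - 2 * e)). w (D * E\<^sup>2))"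
    using sum.reindex_bij_betw[OF bij_betw_squarefree_times_square, of w n]
    by (simp add: case_prod_unfold)
  also have "\<dots> = (\<Sum>e\<le>n div 2. \<Sum>(E, D)\<in>monic_polys e \<times> sqfree_monic (n - 2 * e). w (D * E\<^sup>2))"
    by (subst sum.Sigma[symmetric]) (auto simp: finite_sqfree_monic)
  also have "\<dots> = (\<Sum>e\<le>n div 2. \<Sum>(E, D)\<in>(monic_polys e :: 'a poly set) \<times> sqfree_monic (n - 2 * e). w D)"
  proof (intro sum.cong refl)
    fix e z assume "e \<in> {..n div 2}" "z \<in> (monic_polys e :: 'a poly set) \<times> (sqfree_monic (n - 2 * e) :: 'a poly set)"
    then show "(case z of (E, D) \<Rightarrow> w (D * E\<^sup>2)) = (case z of (E, D) \<Rightarrow> w D)"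
      by (auto simp: monic_polys_def intro!: assms)
  qed
  also have "\<dots> = (\<Sum>e\<le>n div 2. int (CARD('a) ^ e) * (\<Sum>D\<in>sqfree_monic (n - 2 * e). w D))"
    by (simp add: sum.cartesian_product[symmetric] card_monic_polys)
  finally show ?thesis .
qed

text \<open>
  With \<open>u\<close> marking the degree, this is the coefficientwise form of dividing the generating
  function of all monic polynomials by that of the squares, \<open>1 / (1 - q u\<^sup>2)\<close>.
\<close>

lemma sum_sqfree_monic_eq:
  fixes w :: "'a::{field,finite} poly \<Rightarrow> int"
  assumes "\<And>D E. lead_coeff E = 1 \<Longrightarrow> 2 * degree E \<le> n + 2 \<Longrightarrow> w (D * E\<^sup>2) = w D"
  shows "(\<Sum>D\<in>sqfree_monic (n + 2). w D) =
         (\<Sum>f\<in>monic_polys (n + 2). w f) - int CARD('a) * (\<Sum>f\<in>monic_polys n. w f)"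
proof -
  have "(\<Sum>f\<in>monic_polys (n + 2). w f) =
      (\<Sum>e\<le>Suc (n div 2). int (CARD('a) ^ e) * (\<Sum>D\<in>sqfree_monic (n + 2 - 2 * e). w D))"
    using sum_monic_polys_eq[of "n + 2" w] assms by simp
  also have "\<dots> = (\<Sum>D\<in>sqfree_monic (n + 2). w D) +
      (\<Sum>e\<le>n div 2. int (CARD('a) ^ Suc e) * (\<Sum>D\<in>sqfree_monic (n - 2 * e). w D))"
    \<comment> \<open>The term \<open>e = 0\<close> is the sum sought; shifting the index in the
      others leaves \<open>CARD('a)\<close> times the expansion for \<open>n\<close>.\<close>
    by (subst sum.atMost_Suc_shift) simp
  also have "(\<Sum>e\<le>n div 2. int (CARD('a) ^ Suc e) * (\<Sum>D\<in>sqfree_monic (n - 2 * e). w D)) =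
      int CARD('a) * (\<Sum>f\<in>monic_polys n. w f)"
    using sum_monic_polys_eq[of n w] assms by (simp add: sum_distrib_left mult.assoc)
  finally show ?thesis by simp
qed

lemma card_sqfree_monic:
  "int (card (sqfree_monic (n + 2) :: 'a::{field,finite} poly set)) =
   int CARD('a) ^ (n + 2) - int CARD('a) ^ (n + 1)"
  using sum_sqfree_monic_eq[of n "\<lambda>_ :: 'a poly. 1"] by (simp add: card_monic_polys)

section \<open>Quadratic residues modulo an irreducible polynomial\<close>

lemma smult_2: "smult 2 p = p + (p :: 'a::comm_ring_1 poly)"
  using smult_add_left[of 1 1 p] by simp

text \<open>Translation by 1 permutes the field, so comparing the sums of all elements gives
  \<open>of_nat CARD('a) = 0\<close>; with \<open>2 = 0\<close> and odd cardinality this reads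
  \<open>1 = 0\<close>.\<close>

lemma two_neq_zero_if_odd_card:
  assumes "odd CARD('a::{field,finite})"
  shows "(2 :: 'a) \<noteq> 0"
proof
  assume two: "(2 :: 'a) = 0"
  have "(\<Sum>x\<in>UNIV. x :: 'a) = (\<Sum>x\<in>UNIV. x + 1)"
    by (rule sum.reindex_bij_witness[of _ "\<lambda>x. x + 1" "\<lambda>x. x - 1"]) auto
  then have "(of_nat CARD('a) :: 'a) = 0" by (simp add: sum.distrib)
  moreover obtain k where "CARD('a) = 2 * k + 1" using assms by (elim oddE)
  ultimately show False by (simp add: two)
qed

lemma poly_Legendre_cong:
  assumes "[D = D'] (mod P)"
  shows "poly_Legendre D P = poly_Legendre D' P"
proof -
  have "P dvd D \<longleftrightarrow> P dvd D'" using assms cong_dvd_iff by blast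
  moreover have "[a\<^sup>2 = D] (mod P) \<longleftrightarrow> [a\<^sup>2 = D'] (mod P)" for a
    using assms cong_trans cong_sym by blast
  ultimately show ?thesis by (simp add: poly_Legendre_def)
qed

text \<open>Modulo the prime \<open>P\<close> only 0 has square 0, and a nonzero square has exactly
  the roots \<open>b\<close> and \<open>- b\<close>, which differ because 2 is nonzero in the
  field.\<close>

lemma card_square_roots:
  fixes P f :: "'a::{field,finite} poly"
  assumes "irreducible P" "odd CARD('a)"
  shows "int (card {x \<in> polys_below (degree P). [x\<^sup>2 = f] (mod P)}) = 1 + poly_Legendre f P"
    (is "int (card ?R) = _")
proof -
  have P: "prime_elem P" "P \<noteq> 0" using assms field_poly_irreducible_imp_prime by auto
  consider "P dvd f" | "\<not> P dvd f" "\<exists>a. [a\<^sup>2 = f] (mod P)"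
    | "\<not> P dvd f" "\<not> (\<exists>a. [a\<^sup>2 = f] (mod P))" by blast
  then show ?thesis
  proof cases
    case 1
    have "[x\<^sup>2 = f] (mod P) \<longleftrightarrow> P dvd x" for x
      using 1 P(1) by (metis cong_0_iff cong_dvd_iff cong_def mod_0_imp_dvd
        prime_elem_dvd_power dvd_power zero_less_numeral dvd_trans dvd_eq_mod_eq_0)
    then have "?R = {0}" using dvd_polys_below by auto
    then show ?thesis using 1 by (simp add: poly_Legendre_def)
  next
    case 2
    then obtain a where "[a\<^sup>2 = f] (mod P)" by blast
    define b where "b = a mod P"
    have b: "[b\<^sup>2 = f] (mod P)" using \<open>[a\<^sup>2 = f] (mod P)\<close>
      by (simp add: b_def cong_def power_mod)
    have bV: "b \<in> polys_below (degree P)" using P by (simp add: b_def mod_in_polys_below)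
    have nb: "- b \<in> polys_below (degree P)" using bV by (simp add: polys_below_iff)
    have b0: "b \<noteq> 0" using b 2(1) by (auto simp: cong_0_iff cong_sym_eq[of 0])
    have "b \<noteq> - b"
    proof
      assume "b = - b"
      then have "b + b = 0" by (metis add.right_inverse)
      then have "smult 2 b = 0" by (simp add: smult_2)
      then show False using b0 two_neq_zero_if_odd_card[OF assms(2)] by simp
    qed
    moreover have "?R = {b, - b}"
    proof (intro equalityI subsetI)
      fix x assume x: "x \<in> ?R"
      then have "[x\<^sup>2 = b\<^sup>2] (mod P)" using b cong_trans cong_sym by blast
      then have "P dvd (x - b) * (x - (- b))"
        by (simp add: cong_iff_dvd_diff power2_eq_square algebra_simps)
      then have "P dvd x - b \<or> P dvd x - (- b)"
        using P(1) prime_elem_dvd_mult_iff by blast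
      then have "x - b = 0 \<or> x - (- b) = 0"
        using x bV nb dvd_polys_below polys_below_diff by blast
      then show "x \<in> {b, - b}" by (auto simp: eq_neg_iff_add_eq_0)
    qed (use b bV nb in auto)
    ultimately show ?thesis using 2 by (simp add: poly_Legendre_def)
  next
    case 3
    then have "?R = {}" by blast
    then show ?thesis using 3 by (simp add: poly_Legendre_def)
  qed
qed

text \<open>Turns a character sum over reduced residues into a point count. The sets of square roots
  of distinct elements of \<open>A\<close> are disjoint, since each element is its own
  remainder.\<close>

lemma sum_card_square_roots:
  fixes P :: "'a::{field,finite} poly"
  assumes "irreducible P" "odd CARD('a)" "A \<subseteq> polys_below (degree P)"
  shows "(\<Sum>f\<in>A. 1 + poly_Legendre f P) =
         int (card {x \<in> polys_below (degree P). x\<^sup>2 mod P \<in> A})"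
proof -
  have fin: "finite A" using assms(3) finite_subset finite_polys_below by blast
  have "(\<Sum>f\<in>A. 1 + poly_Legendre f P) =
      (\<Sum>f\<in>A. int (card {x \<in> polys_below (degree P). [x\<^sup>2 = f] (mod P)}))"
    by (simp add: card_square_roots assms)
  also have "\<dots> = int (card (\<Union>f\<in>A. {x \<in> polys_below (degree P). [x\<^sup>2 = f] (mod P)}))"
  proof (subst card_UN_disjoint)
    show "\<forall>f\<in>A. \<forall>h\<in>A. f \<noteq> h \<longrightarrow> {x \<in> polys_below (degree P). [x\<^sup>2 = f] (mod P)} \<inter>
        {x \<in> polys_below (degree P). [x\<^sup>2 = h] (mod P)} = {}"
      using assms(3) mod_polys_below[of _ P] by (fastforce simp: cong_def subset_iff)
  qed (simp_all add: fin)
  also have "(\<Union>f\<in>A. {x \<in> polys_below (degree P). [x\<^sup>2 = f] (mod P)}) =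
      {x \<in> polys_below (degree P). x\<^sup>2 mod P \<in> A}"
    using assms(3) mod_polys_below by (force simp: cong_def subset_iff)
  finally show ?thesis .
qed

text \<open>When \<open>A\<close> consists of all residues, the point count is the number of
  residues, which the summands 1 alone already account for.\<close>

lemma sum_poly_Legendre_polys_below:
  fixes P :: "'a::{field,finite} poly"
  assumes "irreducible P" "odd CARD('a)"
  shows "(\<Sum>f\<in>polys_below (degree P). poly_Legendre f P) = 0"
proof -
  have "P \<noteq> 0" using assms by auto
  then have "{x \<in> polys_below (degree P). x\<^sup>2 mod P \<in> polys_below (degree P)} = polys_below (degree P)"
    by (auto simp: mod_in_polys_below)
  then show ?thesis
    using sum_card_square_roots[OF assms order_refl] by (simp add: sum.distrib)
qed

text \<open>Division by \<open>P\<close> writes \<open>f\<close> as \<open>h * P + r\<close> with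
  \<open>h\<close> monic and \<open>r\<close> an arbitrary residue, so the sum is a multiple of the
  complete residue sum, which vanishes.\<close>

lemma sum_poly_Legendre_monic_polys_ge:
  fixes P :: "'a::{field,finite} poly"
  assumes "irreducible P" "odd CARD('a)" "lead_coeff P = 1" "n \<ge> degree P"
  shows "(\<Sum>f\<in>monic_polys n. poly_Legendre f P) = 0"
proof -
  have P0: "P \<noteq> 0" using assms by auto
  define k where "k = n - degree P"
  have n: "n = degree P + k" using assms by (simp add: k_def)
  have "bij_betw (\<lambda>(h, r). h * P + r) (monic_polys k \<times> polys_below (degree P)) (monic_polys n)"
  proof (rule bij_betw_byWitness[where f' = "\<lambda>f. (f div P, f mod P)"])
    have *: "(h * P + r) div P = h \<and> (h * P + r) mod P = r" if "r \<in> polys_below (degree P)" for h r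
      using that P0 div_poly_less mod_poly_less
      by (auto simp: polys_below_iff poly_div_add_left poly_mod_add_left)
    show "\<forall>a\<in>monic_polys k \<times> polys_below (degree P).
        ((case a of (h, r) \<Rightarrow> h * P + r) div P, (case a of (h, r) \<Rightarrow> h * P + r) mod P) = a"
      using * by auto
  next
    show "(\<lambda>(h, r). h * P + r) ` (monic_polys k \<times> polys_below (degree P)) \<subseteq> monic_polys n"
    proof clarify
      fix h r :: "'a poly"
      assume h: "h \<in> monic_polys k" and r: "r \<in> polys_below (degree P)"
      have "P \<in> monic_polys (degree P)" using assms(3) by (simp add: monic_polys_def)
      then have "h * P \<in> monic_polys n"
        unfolding n add.commute[of "degree P"] using h by (intro monic_polys_mult)
      then show "h * P + r \<in> monic_polys n"
        using r by (auto simp: monic_polys_iff polys_below_def n)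
    qed
    show "(\<lambda>f. (f div P, f mod P)) ` monic_polys n \<subseteq> monic_polys k \<times> polys_below (degree P)"
    proof clarify
      fix f :: "'a poly" assume f: "f \<in> monic_polys n"
      have r: "f mod P \<in> polys_below (degree P)" using P0 mod_in_polys_below by blast
      \<comment> \<open>The remainder has degree below \<open>degree P \<le> n\<close>, so removing
        it leaves a monic polynomial of degree \<open>n\<close>.\<close>
      have "f div P * P = f - f mod P" by (simp add: minus_mod_eq_div_mult)
      also have "\<dots> \<in> monic_polys n"
        using f r by (auto simp: monic_polys_iff polys_below_def n)
      finally have m: "f div P * P \<in> monic_polys n" .
      then have "f div P \<noteq> 0" by (auto simp: monic_polys_def)
      moreover have "lead_coeff (f div P) = 1"
        using m assms(3) lead_coeff_mult[of "f div P" P] by (simp add: monic_polys_def)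
      ultimately have "f div P \<in> monic_polys k"
        using m P0 by (auto simp: monic_polys_def n degree_mult_eq)
      then show "f div P \<in> monic_polys k \<and> f mod P \<in> polys_below (degree P)" using r by blast
    qed
  qed (use P0 in auto)
  from sum.reindex_bij_betw[OF this, of "\<lambda>f. poly_Legendre f P"]
  have "(\<Sum>f\<in>monic_polys n. poly_Legendre f P) =
      (\<Sum>(h, r)\<in>monic_polys k \<times> polys_below (degree P). poly_Legendre (h * P + r) P)"
    by (simp add: case_prod_unfold)
  also have "\<dots> = (\<Sum>(h, r)\<in>(monic_polys k :: 'a poly set) \<times> polys_below (degree P). poly_Legendre r P)"
    by (intro sum.cong refl) (auto intro!: poly_Legendre_cong simp: cong_def)
  also have "\<dots> = 0"
    using sum_poly_Legendre_polys_below[OF assms(1,2)]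
    by (simp add: sum.cartesian_product[symmetric])
  finally show ?thesis .
qed

text \<open>\<open>E\<close> is invertible modulo \<open>P\<close>, so the square roots of
  \<open>D * E\<^sup>2\<close> are those of \<open>D\<close> multiplied by \<open>E\<close>.\<close>

lemma poly_Legendre_mult_square:
  fixes P :: "'a::{field,finite} poly"
  assumes "irreducible P" "\<not> P dvd E"
  shows "poly_Legendre (D * E\<^sup>2) P = poly_Legendre D P"
proof -
  let ?V = "polys_below (degree P) :: 'a poly set"
  have P: "prime_elem P" "P \<noteq> 0" using assms field_poly_irreducible_imp_prime by auto
  \<comment> \<open>An injection of the finite set of residues into itself is surjective; this
    supplies division by \<open>E\<close> modulo \<open>P\<close>.\<close>
  have "inj_on (\<lambda>x. x * E mod P) ?V"
  proof (rule inj_onI)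
    fix x y assume xy: "x \<in> ?V" "y \<in> ?V" "x * E mod P = y * E mod P"
    then have "P dvd (x - y) * E" by (simp add: mod_eq_dvd_iff algebra_simps)
    then have "P dvd x - y" using P(1) assms(2) prime_elem_dvd_mult_iff by blast
    then show "x = y" using xy dvd_polys_below polys_below_diff by fastforce
  qed
  then have "(\<lambda>x. x * E mod P) ` ?V = ?V"
    using P(2) by (intro endo_inj_surj) (auto intro: mod_in_polys_below)
  moreover have "a mod P \<in> ?V" for a using P(2) mod_in_polys_below by blast
  ultimately have surj: "\<exists>x. [a = x * E] (mod P)" for a
    unfolding cong_def by (metis (no_types, lifting) imageE)
  have canc: "[x * E\<^sup>2 = y * E\<^sup>2] (mod P) \<longleftrightarrow> [x = y] (mod P)" for x y
  proof -
    have "[x * E\<^sup>2 = y * E\<^sup>2] (mod P) \<longleftrightarrow> P dvd (x - y) * E\<^sup>2"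
      by (simp add: cong_iff_dvd_diff algebra_simps)
    also have "\<dots> \<longleftrightarrow> P dvd x - y"
      using P(1) assms(2) prime_elem_dvd_mult_iff prime_elem_dvd_power by blast
    finally show ?thesis by (simp add: cong_iff_dvd_diff)
  qed
  have "P dvd D * E\<^sup>2 \<longleftrightarrow> P dvd D" using canc[of D 0] by (simp add: cong_0_iff)
  moreover have "(\<exists>a. [a\<^sup>2 = D * E\<^sup>2] (mod P)) \<longleftrightarrow> (\<exists>a. [a\<^sup>2 = D] (mod P))"
  proof
    assume "\<exists>a. [a\<^sup>2 = D * E\<^sup>2] (mod P)"
    then obtain a where a: "[a\<^sup>2 = D * E\<^sup>2] (mod P)" by blast
    obtain x where "[a = x * E] (mod P)" using surj by blast
    then have "[(x * E)\<^sup>2 = D * E\<^sup>2] (mod P)"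
      using a cong_pow cong_sym cong_trans by blast
    then show "\<exists>a. [a\<^sup>2 = D] (mod P)" using canc by (auto simp: power_mult_distrib)
  next
    assume "\<exists>a. [a\<^sup>2 = D] (mod P)"
    then show "\<exists>a. [a\<^sup>2 = D * E\<^sup>2] (mod P)" using canc by (metis power_mult_distrib)
  qed
  ultimately show ?thesis by (simp add: poly_Legendre_def)
qed

section \<open>Values of a quadratic form on the residues\<close>

text \<open>The fibres of a nonzero linear functional are translates of one another, hence equally
  large, and there are \<open>CARD('a)\<close> of them.\<close>

lemma card_linear_fibre:
  fixes L :: "'a::{field,finite} poly \<Rightarrow> 'a"
  assumes add: "\<And>x y. L (x + y) = L x + L y" and smult: "\<And>c x. L (smult c x) = c * L x"
    and a0: "a0 \<in> polys_below n" "L a0 \<noteq> 0"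
  shows "CARD('a) * card {a \<in> polys_below n. L a = t} = CARD('a) ^ n"
proof -
  let ?F = "\<lambda>t. {a \<in> polys_below n. L a = t}"
  have diff: "L (x - y) = L x - L y" for x y
    using add[of "x - y" y] by simp
  have "card (?F s) = card (?F t)" for s
  proof (rule bij_betw_same_card, rule bij_betw_byWitness)
    \<comment> \<open>The multiple of \<open>a0\<close> on which \<open>L\<close> takes the value
      \<open>t - s\<close>.\<close>
    let ?z = "smult ((t - s) / L a0) a0"
    have z: "?z \<in> polys_below n" "L ?z = t - s"
      using a0 by (auto simp: polys_below_smult smult)
    show "(\<lambda>a. a + ?z) ` ?F s \<subseteq> ?F t" "(\<lambda>a. a - ?z) ` ?F t \<subseteq> ?F s"
      using z by (auto intro: polys_below_add polys_below_diff simp: add diff)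
  qed auto
  then have "(\<Sum>s\<in>(UNIV :: 'a set). card (?F s)) = (\<Sum>s\<in>(UNIV :: 'a set). card (?F t))"
    by (intro sum.cong refl)
  then have "(\<Sum>s\<in>UNIV. card (?F s)) = CARD('a) * card (?F t)" by simp
  moreover have "(\<Sum>s\<in>UNIV. card (?F s)) = card (\<Union>s\<in>UNIV. ?F s)"
    by (subst card_UN_disjoint) auto
  moreover have "(\<Union>s\<in>UNIV. ?F s) = polys_below n" by auto
  ultimately show ?thesis by (simp add: card_polys_below)
qed

text \<open>The inverse separates the lowest \<open>m\<close> coefficients, kept by
  \<open>poly_cutoff\<close>, from the others, given by \<open>poly_shift\<close>.\<close>

lemma bij_betw_polys_below_add:
  "bij_betw (\<lambda>(b, a). a + monom 1 m * b) (polys_below n \<times> polys_below m)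
     (polys_below (m + n) :: 'a::{field,finite} poly set)"
proof (rule bij_betw_byWitness[where f' = "\<lambda>f. (poly_shift m f, poly_cutoff m f)"])
  show "\<forall>x\<in>polys_below n \<times> polys_below m.
      (poly_shift m (case x of (b, a) \<Rightarrow> a + monom 1 m * b),
       poly_cutoff m (case x of (b, a) \<Rightarrow> a + monom 1 m * b)) = (x :: 'a poly \<times> 'a poly)"
    by (auto simp: polys_below_def poly_eq_iff coeff_poly_shift coeff_poly_cutoff coeff_monom_mult)
  show "\<forall>f\<in>polys_below (m + n).
      (case (poly_shift m f, poly_cutoff m f) of (b, a) \<Rightarrow> a + monom 1 m * b) = (f :: 'a poly)"
    by (auto simp: poly_eq_iff coeff_poly_shift coeff_poly_cutoff coeff_monom_mult)
qed (auto simp: polys_below_def coeff_poly_shift coeff_poly_cutoff coeff_monom_mult)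

text \<open>
  The functional \<open>f \<mapsto> coeff (f mod P) (2 g - 1)\<close> turns squaring into a quadratic form on the residues
  modulo \<open>P\<close>. It vanishes on polynomials of degree below \<open>g\<close>, a totally isotropic subspace of
  half the dimension, so the form is affine in \<open>a\<close> along \<open>a + T\<^sup>g b\<close> for fixed \<open>b\<close>.
\<close>

lemma card_top_coeff_square_eq_1:
  fixes P :: "'a::{field,finite} poly"
  assumes "degree P = 2 * g" "g \<ge> 1" "odd CARD('a)"
  shows "card {x \<in> polys_below (2 * g). coeff (x\<^sup>2 mod P) (2 * g - 1) = 1} =
         (CARD('a) ^ g - 1) * CARD('a) ^ (g - 1)"
proof -
  let ?q = "CARD('a)"
  define l where "l f = coeff (f mod P) (2 * g - 1)" for f :: "'a poly"
  have l_add: "l (x + y) = l x + l y" and l_smult: "l (smult c x) = c * l x" for x y c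
    by (simp_all add: l_def poly_mod_add_left mod_smult_left)
  have l_small: "l f = coeff f (2 * g - 1)" if "degree f < 2 * g" for f
    using that assms(1) by (simp add: l_def mod_poly_less)
  define N where "N b = card {a \<in> polys_below g. l ((a + monom 1 g * b)\<^sup>2) = 1}" for b :: "'a poly"
  have isotropic: "l (a\<^sup>2) = 0" if "a \<in> polys_below g" for a
  proof -
    have "degree a < g" using that assms(2) by (auto simp: polys_below_iff)
    \<comment> \<open>The degree is at most \<open>2 * g - 2\<close>, so there is neither a
      reduction modulo \<open>P\<close> nor a coefficient at \<open>2 * g - 1\<close>.\<close>
    then have d: "degree (a\<^sup>2) < 2 * g - 1" using degree_power_le[of a 2] by linarith
    then have "l (a\<^sup>2) = coeff (a\<^sup>2) (2 * g - 1)" by (intro l_small) linarith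
    also have "\<dots> = 0" using d by (rule coeff_eq_0)
    finally show ?thesis .
  qed
  have N0: "N 0 = 0"
  proof -
    have "{a \<in> polys_below g. l ((a + monom 1 g * 0)\<^sup>2) = 1} = {}" using isotropic by auto
    then show ?thesis unfolding N_def by simp
  qed
  have N1: "N b = ?q ^ (g - 1)" if b: "b \<in> polys_below g" "b \<noteq> 0" for b
  proof -
    \<comment> \<open>The cross term of the square, linear in \<open>a\<close>.\<close>
    define L where "L a = l (smult 2 (monom 1 g * b * a))" for a
    \<comment> \<open>The exponent gives \<open>monom 1 g * b * a0\<close> degree exactly
      \<open>2 * g - 1\<close>, so \<open>l\<close> reads off its leading coefficient, that of
      \<open>b\<close>. As 2 is nonzero, \<open>L\<close> does not vanish at
      \<open>a0\<close>.\<close>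
    define a0 :: "'a poly" where "a0 = monom 1 (g - 1 - degree b)"
    have db: "degree b < g" using b by (auto simp: polys_below_iff)
    have deg: "degree (monom 1 g * b * a0) = 2 * g - 1"
      using b db by (simp add: a0_def degree_mult_eq degree_monom_eq)
    have "L a0 = 2 * l (monom 1 g * b * a0)" by (simp add: L_def l_smult)
    also have "l (monom 1 g * b * a0) = lead_coeff (monom 1 g * b * a0)"
      using deg assms(2) by (subst l_small) auto
    also have "\<dots> = lead_coeff b" by (simp only: lead_coeff_mult a0_def lead_coeff_monom mult_1_left mult_1_right)
    finally have "L a0 \<noteq> 0" using b two_neq_zero_if_odd_card[OF assms(3)] by simp
    moreover have "a0 \<in> polys_below g" using db by (simp add: a0_def polys_below_iff degree_monom_eq)
    ultimately have card: "?q * card {a \<in> polys_below g. L a = t} = ?q ^ g" for t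
      by (intro card_linear_fibre[of L a0])
         (auto simp: L_def l_add l_smult algebra_simps smult_add_right)
    have "l ((a + monom 1 g * b)\<^sup>2) = 1 \<longleftrightarrow> L a = 1 - l ((monom 1 g * b)\<^sup>2)"
      if "a \<in> polys_below g" for a
    proof -
      have "(a + monom 1 g * b)\<^sup>2 = a\<^sup>2 + (smult 2 (monom 1 g * b * a) + (monom 1 g * b)\<^sup>2)"
        by (simp add: smult_2 power2_eq_square algebra_simps)
      then show ?thesis using isotropic[OF that] by (simp only: l_add L_def) (auto simp: algebra_simps)
    qed
    then have "N b = card {a \<in> polys_below g. L a = 1 - l ((monom 1 g * b)\<^sup>2)}"
      unfolding N_def by (metis (mono_tags, lifting) Collect_cong)
    then have "?q * N b = ?q * ?q ^ (g - 1)"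
      using card assms(2) by (simp add: power_eq_if)
    then show ?thesis by simp
  qed
  define \<phi> :: "'a poly \<times> 'a poly \<Rightarrow> 'a poly" where "\<phi> = (\<lambda>(b, a). a + monom 1 g * b)"
  define Z where "Z = {z \<in> polys_below g \<times> polys_below g. l ((\<phi> z)\<^sup>2) = 1}"
  have \<phi>: "bij_betw \<phi> (polys_below g \<times> polys_below g) (polys_below (2 * g))"
    using bij_betw_polys_below_add[of g g, where 'a = 'a] by (simp add: \<phi>_def mult_2)
  have "bij_betw \<phi> Z (\<phi> ` Z)"
    using \<phi> by (rule bij_betw_subset) (auto simp: Z_def)
  also have "\<phi> ` Z = {x \<in> polys_below (2 * g). l (x\<^sup>2) = 1}"
    unfolding bij_betw_imp_surj_on[OF \<phi>, symmetric] Z_def by blast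
  also have "Z = (SIGMA b:polys_below g. {a \<in> polys_below g. l ((a + monom 1 g * b)\<^sup>2) = 1})"
    by (auto simp: Z_def \<phi>_def)
  finally have "bij_betw \<phi> (SIGMA b:polys_below g. {a \<in> polys_below g. l ((a + monom 1 g * b)\<^sup>2) = 1})
      {x \<in> polys_below (2 * g). l (x\<^sup>2) = 1}" .
  from bij_betw_same_card[OF this]
  have "card {x \<in> polys_below (2 * g). l (x\<^sup>2) = 1} = (\<Sum>b\<in>polys_below g. N b)"
    by (simp add: N_def)
  \<comment> \<open>Only the \<open>CARD('a) ^ g - 1\<close> nonzero \<open>b\<close> contribute,
    each of them \<open>CARD('a) ^ (g - 1)\<close>.\<close>
  also have "\<dots> = (\<Sum>b\<in>polys_below g - {0}. N b)"
    using N0 by (subst sum.remove[of _ 0]) auto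
  also have "\<dots> = (?q ^ g - 1) * ?q ^ (g - 1)"
    by (simp add: N1 card_polys_below)
  finally show ?thesis by (simp add: l_def)
qed

section \<open>Evaluation of the character sums and of the mean\<close>

text \<open>As \<open>degree P = 2 * g\<close>, these polynomials are reduced residues, so adding 1
  to each symbol counts the residues whose square reduces to a monic polynomial of degree
  \<open>2 * g - 1\<close>.\<close>

lemma sum_poly_Legendre_monic_polys_top:
  fixes P :: "'a::{field,finite} poly"
  assumes "irreducible P" "odd CARD('a)" "degree P = 2 * g" "g \<ge> 1"
  shows "(\<Sum>f\<in>monic_polys (2 * g - 1). poly_Legendre f P) = - int (CARD('a) ^ (g - 1))"
proof -
  let ?q = "int CARD('a)"
  have P0: "P \<noteq> 0" using assms by auto
  have monic: "f \<in> monic_polys (2 * g - 1) \<longleftrightarrow> f \<in> polys_below (2 * g) \<and> coeff f (2 * g - 1) = 1"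
    for f :: "'a poly"
    using assms(4) by (auto simp: monic_polys_iff)
  have sub: "monic_polys (2 * g - 1) \<subseteq> (polys_below (degree P) :: 'a poly set)"
    unfolding assms(3) using monic by blast
  have "{x \<in> polys_below (2 * g). x\<^sup>2 mod P \<in> monic_polys (2 * g - 1)} =
      {x \<in> polys_below (2 * g). coeff (x\<^sup>2 mod P) (2 * g - 1) = 1}"
    using mod_in_polys_below[OF P0] assms(3) by (simp only: monic simp_thms)
  then have "(\<Sum>f\<in>monic_polys (2 * g - 1). 1 + poly_Legendre f P) =
      int ((CARD('a) ^ g - 1) * CARD('a) ^ (g - 1))"
    using sum_card_square_roots[OF assms(1,2) sub]
    by (simp only: assms(3) card_top_coeff_square_eq_1[OF assms(3,4,2)])
  also have "\<dots> = (?q ^ g - 1) * ?q ^ (g - 1)"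
    by (simp add: of_nat_diff)
  \<comment> \<open>The first power is the number of polynomials summed over; it cancels against the
    summands 1.\<close>
  also have "\<dots> = ?q ^ (2 * g - 1) - ?q ^ (g - 1)"
    using assms(4) by (simp add: left_diff_distrib mult_2 flip: power_add)
  finally show ?thesis by (simp add: sum.distrib card_monic_polys)
qed

lemma sum_poly_Legendre_sqfree_monic:
  fixes P :: "'a::{field,finite} poly"
  assumes "irreducible P" "odd CARD('a)" "lead_coeff P = 1" "degree P = 2 * g" "g \<ge> 1"
  shows "(\<Sum>D\<in>sqfree_monic (2 * g + 1). poly_Legendre D P) = int (CARD('a) ^ g)"
proof -
  have *: "poly_Legendre (D * E\<^sup>2) P = poly_Legendre D P"
    if "lead_coeff E = 1" "2 * degree E \<le> 2 * g - 1 + 2" for D E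
  proof (rule poly_Legendre_mult_square[OF assms(1)])
    \<comment> \<open>The bound forces \<open>degree E \<le> g\<close>, which is less than
      \<open>2 * g\<close>.\<close>
    have "E \<noteq> 0" "degree E < degree P" using that assms(4,5) by auto
    then show "\<not> P dvd E" by (meson dvd_imp_degree_le not_le)
  qed
  have "2 * g - 1 + 2 = 2 * g + 1" using assms(5) by simp
  then have "(\<Sum>D\<in>sqfree_monic (2 * g + 1). poly_Legendre D P) =
      (\<Sum>f\<in>monic_polys (2 * g + 1). poly_Legendre f P) -
      int CARD('a) * (\<Sum>f\<in>monic_polys (2 * g - 1). poly_Legendre f P)"
    using sum_sqfree_monic_eq[of "2 * g - 1" "\<lambda>D. poly_Legendre D P"] * by simp
  also have "\<dots> = int (CARD('a) * CARD('a) ^ (g - 1))"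
    using sum_poly_Legendre_monic_polys_top[OF assms(1,2,4,5)] assms
    by (simp add: sum_poly_Legendre_monic_polys_ge)
  also have "CARD('a) * CARD('a) ^ (g - 1) = CARD('a) ^ g"
    using assms(5) by (simp add: power_eq_if)
  finally show ?thesis .
qed

theorem theorem1p1:
  fixes q g :: nat and P :: "'a::{field,finite} poly"
  assumes "q = CARD('a)" and "odd q"
    and "g \<ge> 1"
    and "lead_coeff P = 1" and "irreducible P" and "degree P = 2 * g"
  shows "M_mean g P = 1 / (real q - 1)"
proof -
  \<comment> \<open>0 and 1 are distinct, so \<open>q \<ge> 2\<close> and the final division is not
    by zero.\<close>
  have "card {0, 1 :: 'a} \<le> CARD('a)" by (rule card_mono) auto
  then have q1: "q \<ge> 2" using assms(1) by simp
  \<comment> \<open>The degree of \<open>P\<close> is even, so \<open>poly_abs P\<close> is an exact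
    square.\<close>
  have "sqrt (poly_abs P) = sqrt ((real q ^ g)\<^sup>2)"
    using assms by (auto simp: poly_abs_def simp flip: power_mult) (simp add: mult.commute)
  then have sq: "sqrt (poly_abs P) = real q ^ g" by simp
  have "int (card (sqfree_monic (2 * g + 1) :: 'a poly set)) = int q ^ (2 * g) * (int q - 1)"
    using card_sqfree_monic[of "2 * g - 1", where 'a = 'a] assms(1,3)
    by (simp add: algebra_simps)
  then have "real_of_int (int (card (sqfree_monic (2 * g + 1) :: 'a poly set))) =
      real_of_int (int q ^ (2 * g) * (int q - 1))" by (rule arg_cong)
  then have card: "real (card (sqfree_monic (2 * g + 1) :: 'a poly set)) =
      real q ^ (2 * g) * (real q - 1)" by simp
  have "(\<Sum>D\<in>sqfree_monic (2 * g + 1). real_of_int (chi D P) * sqrt (poly_abs P)) =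
      real_of_int (\<Sum>D\<in>sqfree_monic (2 * g + 1). poly_Legendre D P) * real q ^ g"
    using assms by (simp add: chi_irreducible sq sum_distrib_right)
  also have "\<dots> = real q ^ g * real q ^ g"
    using sum_poly_Legendre_sqfree_monic[of P g] assms by simp
  also have "\<dots> = real q ^ (2 * g)" by (simp add: mult_2 power_add)
  finally have sum: "(\<Sum>D\<in>sqfree_monic (2 * g + 1). real_of_int (chi D P) * sqrt (poly_abs P)) =
      real q ^ (2 * g)" .
  show ?thesis unfolding M_mean_def card sum using q1 by simp
qed

end
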